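(* Let $J$ and $X$ be solutions of the SDYM3 equation $D_{\bar y}(J^{-1}J_y)+D_z(J^{-1}J_z)=0$ and the PSDYM3 equation $X_{y\bar y}+X_{zz}+[X_z,X_{\bar y}]=0$, respectively, connected by $J^{-1}J_y=X_z$, $J^{-1}J_z=-X_{\bar y}$. Let $Q^{(0)}$ be an SDYM3 symmetry characteristic and let $\Phi^{(0)}=I\{Q^{(0)}\}=\hat RJ^{-1}Q^{(0)}$ be the $I$-related PSDYM3 symmetry characteristic. Put $$Q^{(n)}=\hat T^nQ^{(0)},\qquad \Phi^{(n)}=\hat R^n\Phi^{(0)},\qquad n=0,1,2,\dots$$ where $\hat R=D_z^{-1}\hat A_y$ and $\hat T=J\hat RJ^{-1}$. If the set $\{Q^{(n)}\}_{n\ge 0}$ generates an infinite-dimensional Lie subalgebra of SDYM3 symmetries (i.e. its linear span is infinite-dimensional and closed under the Lie bracket of characteristics), then the set $\{\Phi^{(n)}\}_{n\ge0}$ generates, in the same sense, an infinite-dimensional Lie subalgebra of PSDYM3 symmetries, isomorphic to the SDYM3 symmetry subalgebra.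
   Context: The independent variables are $y,z,\bar y$ (complex, treated as three independent variables). $D_y,D_z,D_{\bar y}$ are the total derivatives, also denoted by subscripts; they commute and satisfy the Leibniz rule. $J$ is $SL(N,\mathbb{C})$-valued, $X$ is $sl(N,\mathbb{C})$-valued. $[\cdot,\cdot]$ applied to matrices is the matrix commutator, and applied to operators it is the operator commutator. An operator acts on the entire product to its right. The covariant derivative operators are $$\hat A_y=D_y+[J^{-1}J_y,\ \cdot\ ]=D_y+[X_z,\ \cdot\ ],\qquad \hat A_z=D_z+[J^{-1}J_z,\ \cdot\ ]=D_z-[X_{\bar y},\ \cdot\ ],$$ and $D_z^{-1}$ is formal integration in $z$, linear, with $D_zD_z^{-1}=\mathrm{id}$. $Q$ is an SDYM3 symmetry characteristic if $(D_{\bar y}\hat A_y+D_z\hat A_z)(J^{-1}Q)=0$ on solutions. $\Phi$ is a PSDYM3 symmetry characteristic if $(D_{\bar y}\hat A_y+D_z\hat A_z)\Phi=0$ on solutions. Characteristics are matrix-valued and possibly nonlocal in $J$, $X$. $\hat T$ maps SDYM3 characteristics to SDYM3 characteristics, and $\hat R$ maps PSDYM3 characteristics to PSDYM3 characteristics. The map $I$ from SDYM3 characteristics to PSDYM3 characteristics is $I\{Q\}=\hat RJ^{-1}Q$. When $\hat R$ is applied to a function $\phi$ satisfying $(D_{\bar y}\hat A_y+D_z\hat A_z)\phi=0$, $\hat R\phi$ denotes the common solution $\phi'$ of the consistent system $\phi'_z=\hat A_y\phi$, $\phi'_{\bar y}=-\hat A_z\phi$. Arbitrary additive terms (solutions of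 the homogeneous equations, both when solving for $\phi'$ given $\phi$ and when solving for $\phi$ given $\phi'$) are ignored, so that $I$ is a one-to-one linear correspondence. Fréchet derivative: to a pair $(Q,\Phi)$ with $\Phi=I\{Q\}$ corresponds the linear operator $\Delta$ with $\Delta J=Q$, $\Delta X=\Phi$, which annihilates functions of $y,z,\bar y$ alone, satisfies the Leibniz rule, and commutes with all total derivatives and their powers (including $D_z^{-1}$). For characteristics $Q^{(l)}=\Delta^{(l)}J$ and $\Phi^{(l)}=\Delta^{(l)}X=I\{Q^{(l)}\}$, the Lie brackets are $$[\Delta^{(i)},\Delta^{(j)}]J=\Delta^{(i)}Q^{(j)}-\Delta^{(j)}Q^{(i)},\qquad [\Delta^{(i)},\Delta^{(j)}]X=\Delta^{(i)}\Phi^{(j)}-\Delta^{(j)}\Phi^{(i)},$$ which are again symmetry characteristics of SDYM3 and PSDYM3, respectively. *)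

theory Defs
  imports "HOL-Analysis.Analysis"
begin

section \<open>Functions and total derivatives\<close>

text \<open>
  The elements of \<open>'a\<close> are the scalar functions of \<open>y, z, ybar\<close> and of the fields, local or
  nonlocal, evaluated on solutions: an identity that the theory asserts ``on solutions'' is an
  equation in \<open>'a\<close>. Complex constants embed by \<open>cnst\<close>; the set \<open>base\<close> contains the functions of
  the independent variables alone; \<open>Dzi\<close> is the formal integration in \<open>z\<close>.
\<close>

record 'a calc =
  cnst :: "complex \<Rightarrow> 'a"
  var_y :: 'a
  var_z :: 'a
  var_yb :: 'a
  base :: "'a set"
  Dy :: "'a \<Rightarrow> 'a"
  Dz :: "'a \<Rightarrow> 'a"
  Dyb :: "'a \<Rightarrow> 'a"
  Dzi :: "'a \<Rightarrow> 'a"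

definition clinear_op :: "'a::comm_ring_1 calc \<Rightarrow> ('a \<Rightarrow> 'a) \<Rightarrow> bool" where
  "clinear_op C D \<longleftrightarrow>
     (\<forall>f g. D (f + g) = D f + D g) \<and> (\<forall>c f. D (cnst C c * f) = cnst C c * D f)"

definition leibniz :: "('a::comm_ring_1 \<Rightarrow> 'a) \<Rightarrow> bool" where
  "leibniz D \<longleftrightarrow> (\<forall>f g. D (f * g) = D f * g + f * D g)"

definition differential_calculus :: "'a::comm_ring_1 calc \<Rightarrow> bool" where
  "differential_calculus C \<longleftrightarrow>
     cnst C 1 = 1 \<and>
     (\<forall>a b. cnst C (a + b) = cnst C a + cnst C b) \<and>
     (\<forall>a b. cnst C (a * b) = cnst C a * cnst C b) \<and>
     (\<forall>D \<in> {Dy C, Dz C, Dyb C}. clinear_op C D \<and> leibniz D) \<and>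
     Dy C \<circ> Dz C = Dz C \<circ> Dy C \<and>
     Dy C \<circ> Dyb C = Dyb C \<circ> Dy C \<and>
     Dz C \<circ> Dyb C = Dyb C \<circ> Dz C \<and>
     Dy C (var_y C) = 1 \<and> Dy C (var_z C) = 0 \<and> Dy C (var_yb C) = 0 \<and>
     Dz C (var_y C) = 0 \<and> Dz C (var_z C) = 1 \<and> Dz C (var_yb C) = 0 \<and>
     Dyb C (var_y C) = 0 \<and> Dyb C (var_z C) = 0 \<and> Dyb C (var_yb C) = 1 \<and>
     range (cnst C) \<subseteq> base C \<and> {var_y C, var_z C, var_yb C} \<subseteq> base C \<and>
     (\<forall>f\<in>base C. \<forall>g\<in>base C. f + g \<in> base C \<and> f * g \<in> base C) \<and>
     (\<forall>f\<in>base C. Dy C f \<in> base C \<and> Dz C f \<in> base C \<and> Dyb C f \<in> base C) \<and>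
     clinear_op C (Dzi C) \<and> (\<forall>f. Dz C (Dzi C f) = f)"


section \<open>Matrix-valued functions\<close>

definition entrywise :: "('a \<Rightarrow> 'a) \<Rightarrow> 'a^'n^'n \<Rightarrow> 'a^'n^'n" where
  "entrywise F M = (\<chi> i j. F (M $ i $ j))"

definition cscale :: "'a::comm_ring_1 calc \<Rightarrow> complex \<Rightarrow> 'a^'n^'n \<Rightarrow> 'a^'n^'n" where
  "cscale C c M = (\<chi> i j. cnst C c * M $ i $ j)"

abbreviation cspan :: "'a::comm_ring_1 calc \<Rightarrow> ('a^'n^'n) set \<Rightarrow> ('a^'n^'n) set" where
  "cspan C \<equiv> module.span (cscale C)"

abbreviation csubspace :: "'a::comm_ring_1 calc \<Rightarrow> ('a^'n^'n) set \<Rightarrow> bool" where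
  "csubspace C \<equiv> module.subspace (cscale C)"

lemma vector_space_cscale:
  assumes "differential_calculus C"
  shows "vector_space (cscale C :: complex \<Rightarrow> 'a::comm_ring_1^'n^'n \<Rightarrow> 'a^'n^'n)"
  using assms
  by unfold_locales
    (auto simp: differential_calculus_def cscale_def vec_eq_iff algebra_simps)

abbreviation mDy :: "'a::comm_ring_1 calc \<Rightarrow> 'a^'n^'n \<Rightarrow> 'a^'n^'n" where
  "mDy C \<equiv> entrywise (Dy C)"
abbreviation mDz :: "'a::comm_ring_1 calc \<Rightarrow> 'a^'n^'n \<Rightarrow> 'a^'n^'n" where
  "mDz C \<equiv> entrywise (Dz C)"
abbreviation mDyb :: "'a::comm_ring_1 calc \<Rightarrow> 'a^'n^'n \<Rightarrow> 'a^'n^'n" where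
  "mDyb C \<equiv> entrywise (Dyb C)"
abbreviation mDzi :: "'a::comm_ring_1 calc \<Rightarrow> 'a^'n^'n \<Rightarrow> 'a^'n^'n" where
  "mDzi C \<equiv> entrywise (Dzi C)"

definition mcomm :: "'a::comm_ring_1^'n^'n \<Rightarrow> 'a^'n^'n \<Rightarrow> 'a^'n^'n" where
  "mcomm A B = A ** B - B ** A"

text \<open>Over a commutative ring the library has no link between \<open>det\<close> and \<open>invertible\<close>.\<close>

definition SL_valued :: "'a::comm_ring_1^'n^'n \<Rightarrow> bool" where
  "SL_valued J \<longleftrightarrow> invertible J \<and> det J = 1"

definition sl_valued :: "'a::comm_ring_1^'n^'n \<Rightarrow> bool" where
  "sl_valued X \<longleftrightarrow> trace X = 0"


section \<open>The two equations and their symmetry conditions\<close>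

definition sdym3 :: "'a::comm_ring_1 calc \<Rightarrow> 'a^'n^'n \<Rightarrow> bool" where
  "sdym3 C J \<longleftrightarrow>
     mDyb C (matrix_inv J ** mDy C J) + mDz C (matrix_inv J ** mDz C J) = 0"

definition psdym3 :: "'a::comm_ring_1 calc \<Rightarrow> 'a^'n^'n \<Rightarrow> bool" where
  "psdym3 C X \<longleftrightarrow>
     mDyb C (mDy C X) + mDz C (mDz C X) + mcomm (mDz C X) (mDyb C X) = 0"

definition connected_fields :: "'a::comm_ring_1 calc \<Rightarrow> 'a^'n^'n \<Rightarrow> 'a^'n^'n \<Rightarrow> bool" where
  "connected_fields C J X \<longleftrightarrow>
     matrix_inv J ** mDy C J = mDz C X \<and> matrix_inv J ** mDz C J = - mDyb C X"

definition hatAy :: "'a::comm_ring_1 calc \<Rightarrow> 'a^'n^'n \<Rightarrow> 'a^'n^'n \<Rightarrow> 'a^'n^'n" where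
  "hatAy C J \<phi> = mDy C \<phi> + mcomm (matrix_inv J ** mDy C J) \<phi>"

definition hatAz :: "'a::comm_ring_1 calc \<Rightarrow> 'a^'n^'n \<Rightarrow> 'a^'n^'n \<Rightarrow> 'a^'n^'n" where
  "hatAz C J \<phi> = mDz C \<phi> + mcomm (matrix_inv J ** mDz C J) \<phi>"

lemma hatA_connected:
  assumes "connected_fields C J X"
  shows "hatAy C J \<phi> = mDy C \<phi> + mcomm (mDz C X) \<phi>"
    and "hatAz C J \<phi> = mDz C \<phi> - mcomm (mDyb C X) \<phi>"
  using assms
  by (simp_all add: connected_fields_def hatAy_def hatAz_def mcomm_def
      matrix_matrix_mult_def vec_eq_iff sum_negf)

definition psdym3_characteristic :: "'a::comm_ring_1 calc \<Rightarrow> 'a^'n^'n \<Rightarrow> 'a^'n^'n \<Rightarrow> bool" where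
  "psdym3_characteristic C J \<Phi> \<longleftrightarrow> mDyb C (hatAy C J \<Phi>) + mDz C (hatAz C J \<Phi>) = 0"

definition sdym3_characteristic :: "'a::comm_ring_1 calc \<Rightarrow> 'a^'n^'n \<Rightarrow> 'a^'n^'n \<Rightarrow> bool" where
  "sdym3_characteristic C J Q \<longleftrightarrow>
     mDyb C (hatAy C J (matrix_inv J ** Q)) + mDz C (hatAz C J (matrix_inv J ** Q)) = 0"

definition hatR :: "'a::comm_ring_1 calc \<Rightarrow> 'a^'n^'n \<Rightarrow> 'a^'n^'n \<Rightarrow> 'a^'n^'n" where
  "hatR C J \<phi> = mDzi C (hatAy C J \<phi>)"

definition hatT :: "'a::comm_ring_1 calc \<Rightarrow> 'a^'n^'n \<Rightarrow> 'a^'n^'n \<Rightarrow> 'a^'n^'n" where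
  "hatT C J Q = J ** hatR C J (matrix_inv J ** Q)"

definition mapI :: "'a::comm_ring_1 calc \<Rightarrow> 'a^'n^'n \<Rightarrow> 'a^'n^'n \<Rightarrow> 'a^'n^'n" where
  "mapI C J Q = hatR C J (matrix_inv J ** Q)"

text \<open>
  Ignoring the arbitrary additive terms amounts to choosing linear spaces \<open>SQ\<close> of SDYM3 and \<open>SP\<close>
  of PSDYM3 characteristics that contain no nonzero solution of the homogeneous equations.
  They cannot consist of all solutions of the symmetry conditions: for a constant matrix \<open>c\<close>,
  \<open>Q = c J\<close> satisfies the SDYM3 condition and is mapped to zero, and \<open>\<Phi> = c\<close> solves
  \<open>\<Phi>\<^sub>z = \<Phi>\<^sub>y\<^sub>b = 0\<close>. That \<open>hatR\<close> yields the common solution of \<open>\<phi>'\<^sub>z = hatAy \<phi>\<close>,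
  \<open>\<phi>'\<^sub>y\<^sub>b = - hatAz \<phi>\<close> has to be required for the second equation only; the first one
  follows from \<open>Dz \<circ> Dzi = id\<close>.
\<close>

definition characteristic_spaces ::
  "'a::comm_ring_1 calc \<Rightarrow> 'a^'n^'n \<Rightarrow> ('a^'n^'n) set \<Rightarrow> ('a^'n^'n) set \<Rightarrow> bool" where
  "characteristic_spaces C J SQ SP \<longleftrightarrow>
     csubspace C SQ \<and> csubspace C SP \<and>
     (\<forall>Q\<in>SQ. sdym3_characteristic C J Q) \<and>
     (\<forall>\<Phi>\<in>SP. psdym3_characteristic C J \<Phi>) \<and>
     (\<forall>\<phi> \<in> SP \<union> (\<lambda>Q. matrix_inv J ** Q) ` SQ.
        mDyb C (hatR C J \<phi>) = - hatAz C J \<phi>) \<and>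
     (\<forall>Q\<in>SQ. hatAy C J (matrix_inv J ** Q) = 0 \<and> hatAz C J (matrix_inv J ** Q) = 0
        \<longrightarrow> Q = 0) \<and>
     (\<forall>\<Phi>\<in>SP. mDz C \<Phi> = 0 \<and> mDyb C \<Phi> = 0 \<longrightarrow> \<Phi> = 0) \<and>
     hatT C J ` SQ \<subseteq> SQ \<and> hatR C J ` SP \<subseteq> SP \<and> mapI C J ` SQ = SP"


section \<open>Frechet derivatives and Lie brackets\<close>

definition frechet_operator ::
  "'a::comm_ring_1 calc \<Rightarrow> 'a^'n^'n \<Rightarrow> 'a^'n^'n \<Rightarrow> 'a^'n^'n \<Rightarrow> 'a^'n^'n \<Rightarrow> ('a \<Rightarrow> 'a) \<Rightarrow> bool" where
  "frechet_operator C J X Q \<Phi> \<Delta> \<longleftrightarrow>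
     clinear_op C \<Delta> \<and> leibniz \<Delta> \<and> (\<forall>f\<in>base C. \<Delta> f = 0) \<and>
     (\<forall>D \<in> {Dy C, Dz C, Dyb C, Dzi C}. \<Delta> \<circ> D = D \<circ> \<Delta>) \<and>
     entrywise \<Delta> J = Q \<and> entrywise \<Delta> X = \<Phi>"

text \<open>The \<open>THE\<close> below is well defined under \<open>frechet_derivatives_exist\<close>.\<close>

definition frechet ::
  "'a::comm_ring_1 calc \<Rightarrow> 'a^'n^'n \<Rightarrow> 'a^'n^'n \<Rightarrow> 'a^'n^'n \<Rightarrow> 'a^'n^'n \<Rightarrow> 'a \<Rightarrow> 'a" where
  "frechet C J X Q \<Phi> = (THE \<Delta>. frechet_operator C J X Q \<Phi> \<Delta>)"

definition frechet_derivatives_exist ::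
  "'a::comm_ring_1 calc \<Rightarrow> 'a^'n^'n \<Rightarrow> 'a^'n^'n \<Rightarrow> ('a^'n^'n) set \<Rightarrow> bool" where
  "frechet_derivatives_exist C J X SQ \<longleftrightarrow>
     (\<forall>Q\<in>SQ. \<exists>!\<Delta>. frechet_operator C J X Q (mapI C J Q) \<Delta>)"

definition sdym3_bracket ::
  "'a::comm_ring_1 calc \<Rightarrow> 'a^'n^'n \<Rightarrow> 'a^'n^'n \<Rightarrow> 'a^'n^'n \<Rightarrow> 'a^'n^'n \<Rightarrow> 'a^'n^'n" where
  "sdym3_bracket C J X Q Q' =
     entrywise (frechet C J X Q (mapI C J Q)) Q' - entrywise (frechet C J X Q' (mapI C J Q')) Q"

text \<open>
  The operator belonging to a PSDYM3 characteristic \<open>\<Phi>\<close> is that of the pair \<open>(Q, \<Phi>)\<close>, where \<open>Q\<close> is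
  the preimage of \<open>\<Phi>\<close> under the one-to-one correspondence \<open>mapI\<close> from \<open>SQ\<close> to \<open>SP\<close>.
\<close>

definition psdym3_bracket ::
  "'a::comm_ring_1 calc \<Rightarrow> 'a^'n^'n \<Rightarrow> 'a^'n^'n \<Rightarrow> ('a^'n^'n) set \<Rightarrow>
     'a^'n^'n \<Rightarrow> 'a^'n^'n \<Rightarrow> 'a^'n^'n" where
  "psdym3_bracket C J X SQ \<Phi> \<Phi>' =
     entrywise (frechet C J X (the_inv_into SQ (mapI C J) \<Phi>) \<Phi>) \<Phi>'
     - entrywise (frechet C J X (the_inv_into SQ (mapI C J) \<Phi>') \<Phi>') \<Phi>"

definition brackets_closed ::
  "'a::comm_ring_1 calc \<Rightarrow> 'a^'n^'n \<Rightarrow> 'a^'n^'n \<Rightarrow> ('a^'n^'n) set \<Rightarrow> ('a^'n^'n) set \<Rightarrow> bool" where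
  "brackets_closed C J X SQ SP \<longleftrightarrow>
     (\<forall>Q\<in>SQ. \<forall>Q'\<in>SQ. sdym3_bracket C J X Q Q' \<in> SQ) \<and>
     (\<forall>\<Phi>\<in>SP. \<forall>\<Phi>'\<in>SP. psdym3_bracket C J X SQ \<Phi> \<Phi>' \<in> SP)"

definition infinite_dimensional :: "'a::comm_ring_1 calc \<Rightarrow> ('a^'n^'n) set \<Rightarrow> bool" where
  "infinite_dimensional C V \<longleftrightarrow> \<not> (\<exists>B. finite B \<and> V \<subseteq> cspan C B)"

definition generates_inf_dim_lie_subalgebra ::
  "'a::comm_ring_1 calc \<Rightarrow> ('a^'n^'n \<Rightarrow> 'a^'n^'n \<Rightarrow> 'a^'n^'n) \<Rightarrow>
     ('a^'n^'n) set \<Rightarrow> ('a^'n^'n) set \<Rightarrow> bool" where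
  "generates_inf_dim_lie_subalgebra C br G S \<longleftrightarrow>
     S \<subseteq> G \<and> infinite_dimensional C (cspan C S) \<and>
     (\<forall>u\<in>cspan C S. \<forall>v\<in>cspan C S. br u v \<in> cspan C S)"

definition lie_isomorphic ::
  "'a::comm_ring_1 calc \<Rightarrow>
     ('a^'n^'n) set \<Rightarrow> ('a^'n^'n \<Rightarrow> 'a^'n^'n \<Rightarrow> 'a^'n^'n) \<Rightarrow>
     ('a^'n^'n) set \<Rightarrow> ('a^'n^'n \<Rightarrow> 'a^'n^'n \<Rightarrow> 'a^'n^'n) \<Rightarrow> bool" where
  "lie_isomorphic C V br W br' \<longleftrightarrow>
     (\<exists>f. bij_betw f V W \<and>
        (\<forall>u\<in>V. \<forall>v\<in>V. f (u + v) = f u + f v) \<and>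
        (\<forall>c. \<forall>u\<in>V. f (cscale C c u) = cscale C c (f u)) \<and>
        (\<forall>u\<in>V. \<forall>v\<in>V. f (br u v) = br' (f u) (f v)))"

end

theory Submission
  imports Defs
begin

text \<open>
  Put \<open>u = J\<inverse>Q\<close>, so that \<open>I{Q} = D\<^sub>z\<inverse>A\<^sub>y u\<close>. The Frechet operator of \<open>Q\<close> satisfies
  \<open>\<Delta>(J\<inverse>J\<^sub>y) = A\<^sub>y u\<close>, whence \<open>\<Delta>I{Q'} = D\<^sub>z\<inverse>(A\<^sub>y(\<Delta>u') + [A\<^sub>y u, u'])\<close>. Antisymmetrizing, and
  using that \<open>A\<^sub>y\<close> is a derivation of the commutator, gives
  \<open>D\<^sub>z\<inverse>A\<^sub>y(\<Delta>u' - \<Delta>'u + [u, u'])\<close>, and the bracket of \<open>Q\<close> and \<open>Q'\<close> is exactly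
  \<open>J(\<Delta>u' - \<Delta>'u + [u, u'])\<close>. Hence \<open>I\<close> is a Lie algebra homomorphism; it is injective, and
  \<open>I \<circ> T = R \<circ> I\<close> makes it carry \<open>Q\<^sup>(\<^sup>n\<^sup>)\<close> to \<open>\<Phi>\<^sup>(\<^sup>n\<^sup>)\<close>.
\<close>

section \<open>Matrix algebra\<close>

lemma matrix_add_rdistrib: "(B + C) ** (A::'a::comm_ring_1^'n^'m) = B ** A + C ** A"
  by (simp add: matrix_matrix_mult_def vec_eq_iff distrib_right sum.distrib)

lemma matrix_diff_ldistrib: "(A::'a::comm_ring_1^'n^'m) ** (B - C) = A ** B - A ** C"
  by (simp add: matrix_matrix_mult_def vec_eq_iff right_diff_distrib sum_subtractf)

lemma matrix_diff_rdistrib: "(B - C) ** (A::'a::comm_ring_1^'n^'m) = B ** A - C ** A"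
  by (simp add: matrix_matrix_mult_def vec_eq_iff left_diff_distrib sum_subtractf)

lemma matrix_minus_left: "(- A) ** (B::'a::comm_ring_1^'n^'m) = - (A ** B)"
  by (simp add: matrix_matrix_mult_def vec_eq_iff sum_negf)

lemmas matrix_ring_simps = matrix_add_ldistrib matrix_add_rdistrib matrix_diff_ldistrib
  matrix_diff_rdistrib matrix_minus_left matrix_mul_assoc[symmetric]

lemma cscale_matrix_mult_left: "cscale C c A ** B = cscale C c (A ** B)"
  by (simp add: cscale_def matrix_matrix_mult_def vec_eq_iff sum_distrib_left mult.assoc)

lemma cscale_matrix_mult_right: "A ** cscale C c B = cscale C c (A ** B)"
  by (simp add: cscale_def matrix_matrix_mult_def vec_eq_iff sum_distrib_left mult.left_commute)

lemma cscale_add: "cscale C c (A + B) = cscale C c A + cscale C c B"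
  by (simp add: cscale_def vec_eq_iff distrib_left)

lemma cscale_diff: "cscale C c (A - B) = cscale C c A - cscale C c B"
  by (simp add: cscale_def vec_eq_iff right_diff_distrib)

lemma matrix_inv_inverse:
  fixes J :: "'a::comm_ring_1^'n^'n"
  assumes "invertible J"
  shows matrix_inv_right: "J ** matrix_inv J = mat 1"
    and matrix_inv_left: "matrix_inv J ** J = mat 1"
  using someI_ex[OF assms[unfolded invertible_def]] by (simp_all add: matrix_inv_def)

lemma matrix_inv_mult_cancel:
  fixes J :: "'a::comm_ring_1^'n^'n"
  assumes "invertible J"
  shows "matrix_inv J ** (J ** A) = A" "J ** (matrix_inv J ** A) = A"
  using assms by (simp_all add: matrix_mul_assoc matrix_inv_left matrix_inv_right)

section \<open>Entrywise operators\<close>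

lemma clinear_op_additive: "clinear_op C D \<Longrightarrow> Modules.additive D"
  by (simp add: clinear_op_def Modules.additive_def)

lemma entrywise_additive:
  assumes "clinear_op C D"
  shows "Modules.additive (entrywise D)"
  using Modules.additive.add[OF clinear_op_additive[OF assms]]
  by unfold_locales (simp add: entrywise_def vec_eq_iff)

lemmas entrywise_add = Modules.additive.add[OF entrywise_additive]
lemmas entrywise_zero = Modules.additive.zero[OF entrywise_additive]
lemmas entrywise_diff = Modules.additive.diff[OF entrywise_additive]

lemma entrywise_cscale:
  assumes "clinear_op C D"
  shows "entrywise D (cscale C c A) = cscale C c (entrywise D A)"
  using assms by (simp add: clinear_op_def entrywise_def cscale_def vec_eq_iff)

lemma entrywise_mult:
  assumes "clinear_op C D" "leibniz D"
  shows "entrywise D (A ** B) = entrywise D A ** B + A ** entrywise D B"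
  using assms(2)
  by (simp add: entrywise_def matrix_matrix_mult_def vec_eq_iff leibniz_def sum.distrib
      Modules.additive.sum[OF clinear_op_additive[OF assms(1)]])

lemma entrywise_mat_1:
  assumes "clinear_op C D" "leibniz D"
  shows "entrywise D (mat 1) = 0"
proof -
  have "D 1 = D 1 + D 1" using assms(2) by (metis leibniz_def mult_1 mult_1_right)
  then show ?thesis
    by (simp add: entrywise_def mat_def vec_eq_iff Modules.additive.zero[OF clinear_op_additive[OF assms(1)]])
qed

text \<open>Differentiate \<open>matrix_inv J ** J = mat 1\<close> and multiply by
  \<open>matrix_inv J\<close> from the right.\<close>

lemma entrywise_matrix_inv:
  assumes "clinear_op C D" "leibniz D" and inv: "invertible J"
  shows "entrywise D (matrix_inv J) = - (matrix_inv J ** (entrywise D J ** matrix_inv J))"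
proof -
  let ?M = "matrix_inv J"
  have "entrywise D ?M ** J + ?M ** entrywise D J = 0"
    by (simp add: matrix_inv_left[OF inv] entrywise_mat_1[OF assms(1,2)]
        flip: entrywise_mult[OF assms(1,2)])
  then have "(entrywise D ?M ** J + ?M ** entrywise D J) ** ?M = 0" by simp
  then show ?thesis
    by (simp add: matrix_ring_simps matrix_inv_right[OF inv] eq_neg_iff_add_eq_0)
qed

lemma entrywise_commute: "F \<circ> G = G \<circ> F \<Longrightarrow> entrywise F (entrywise G A) = entrywise G (entrywise F A)"
  by (simp add: entrywise_def vec_eq_iff fun_eq_iff)

section \<open>The correspondence as a linear map\<close>

lemma differential_calculusD:
  assumes "differential_calculus C"
  shows "clinear_op C (Dy C)" "leibniz (Dy C)" "clinear_op C (Dz C)" "clinear_op C (Dyb C)"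
    "clinear_op C (Dzi C)" "\<And>f. Dz C (Dzi C f) = f"
  using assms by (simp_all add: differential_calculus_def)

lemma mDz_mDzi:
  assumes "differential_calculus C"
  shows "mDz C (mDzi C A) = A"
  using differential_calculusD(6)[OF assms] by (simp add: entrywise_def vec_eq_iff)

lemma hatAy_add:
  "differential_calculus C \<Longrightarrow> hatAy C J (A + B) = hatAy C J A + hatAy C J B"
  by (simp add: hatAy_def mcomm_def entrywise_add[OF differential_calculusD(1)] matrix_ring_simps)

lemma hatAy_cscale:
  "differential_calculus C \<Longrightarrow> hatAy C J (cscale C c A) = cscale C c (hatAy C J A)"
  by (simp add: hatAy_def mcomm_def entrywise_cscale[OF differential_calculusD(1)] cscale_add
      cscale_diff cscale_matrix_mult_left cscale_matrix_mult_right)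

lemma hatAy_diff:
  "differential_calculus C \<Longrightarrow> hatAy C J (A - B) = hatAy C J A - hatAy C J B"
  by (simp add: hatAy_def mcomm_def entrywise_diff[OF differential_calculusD(1)] matrix_ring_simps)

text \<open>Both \<open>mDy C\<close> and the commutator with a fixed matrix (Jacobi identity) are
  derivations of \<open>mcomm\<close>.\<close>

lemma hatAy_mcomm:
  "differential_calculus C \<Longrightarrow>
    hatAy C J (mcomm A B) = mcomm (hatAy C J A) B + mcomm A (hatAy C J B)"
  by (simp add: hatAy_def mcomm_def entrywise_diff[OF differential_calculusD(1)]
      entrywise_mult[OF differential_calculusD(1,2)] matrix_ring_simps algebra_simps)

lemma linear_mapI:
  fixes J :: "'a::comm_ring_1^'n^'n"
  assumes dc: "differential_calculus C"
  shows "Vector_Spaces.linear (cscale C) (cscale C) (mapI C J)"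
  unfolding Vector_Spaces.linear_iff
  using vector_space_cscale[OF dc]
  by (simp add: mapI_def hatR_def matrix_add_ldistrib cscale_matrix_mult_right hatAy_add[OF dc]
      hatAy_cscale[OF dc] entrywise_add[OF differential_calculusD(5)[OF dc]]
      entrywise_cscale[OF differential_calculusD(5)[OF dc]])

text \<open>By linearity the kernel decides. If \<open>hatR\<close> kills \<open>u\<close>, both
  equations of the system defining \<open>hatR\<close> give \<open>hatAy u = 0\<close> and
  \<open>hatAz u = 0\<close>, and \<open>characteristic_spaces\<close> admits no such nonzero
  \<open>Q\<close>.\<close>

lemma inj_on_mapI:
  fixes J :: "'a::comm_ring_1^'n^'n"
  assumes dc: "differential_calculus C" and cs: "characteristic_spaces C J SQ SP"
  shows "inj_on (mapI C J) SQ"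
proof -
  interpret I: Vector_Spaces.linear "cscale C" "cscale C" "mapI C J"
    by (rule linear_mapI[OF dc])
  have sub: "csubspace C SQ" using cs by (simp add: characteristic_spaces_def)
  have "Q = 0" if Q: "Q \<in> SQ" and 0: "mapI C J Q = 0" for Q
  proof -
    let ?u = "matrix_inv J ** Q"
    have R0: "hatR C J ?u = 0" using 0 by (simp add: mapI_def)
    have "hatAy C J ?u = mDz C (hatR C J ?u)" by (simp add: hatR_def mDz_mDzi[OF dc])
    then have "hatAy C J ?u = 0" by (simp add: R0 entrywise_zero[OF differential_calculusD(3)[OF dc]])
    moreover have "mDyb C (hatR C J ?u) = - hatAz C J ?u"
      using cs Q by (simp add: characteristic_spaces_def)
    then have "hatAz C J ?u = 0" by (simp add: R0 entrywise_zero[OF differential_calculusD(4)[OF dc]])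
    ultimately show ?thesis using cs Q by (simp add: characteristic_spaces_def)
  qed
  then show ?thesis
    using I.inj_on_iff_eq_0[OF sub] by blast
qed

lemma mapI_hatT:
  "invertible J \<Longrightarrow> mapI C J (hatT C J Q) = hatR C J (mapI C J Q)"
  by (simp add: mapI_def hatT_def matrix_inv_mult_cancel)

section \<open>Brackets\<close>

text \<open>\<open>\<Delta>\<close> commutes with \<open>Dy\<close> and \<open>Dzi\<close>, so its
  failure to commute with \<open>hatR\<close> comes only from varying the connection matrix
  \<open>matrix_inv J ** mDy C J\<close>.\<close>

lemma frechet_mapI:
  fixes J X :: "'a::comm_ring_1^'n^'n"
  assumes dc: "differential_calculus C" and inv: "invertible J"
    and fr: "frechet_operator C J X Q P \<Delta>"
  shows "entrywise \<Delta> (mapI C J Q') =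
    mDzi C (hatAy C J (entrywise \<Delta> (matrix_inv J ** Q')) +
      mcomm (hatAy C J (matrix_inv J ** Q)) (matrix_inv J ** Q'))"
proof -
  let ?M = "matrix_inv J" and ?D = "entrywise \<Delta>"
  have lin: "clinear_op C \<Delta>" and leib: "leibniz \<Delta>" and DJ: "?D J = Q"
    and comm: "\<Delta> \<circ> Dy C = Dy C \<circ> \<Delta>" "\<Delta> \<circ> Dzi C = Dzi C \<circ> \<Delta>"
    using fr by (simp_all add: frechet_operator_def)
  note mult = entrywise_mult[OF lin leib]
  note cancel = matrix_inv_mult_cancel[OF inv]
  \<comment> \<open>Product rule for \<open>Q = J u\<close>; it turns the variation
    \<open>- u B + B u + D_y u\<close> of \<open>B = matrix_inv J ** mDy C J\<close> into
    \<open>hatAy u\<close>.\<close>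
  have Qy: "mDy C Q = mDy C J ** (?M ** Q) + J ** mDy C (?M ** Q)"
    using entrywise_mult[OF differential_calculusD(1,2)[OF dc], of J "?M ** Q"] by (simp add: cancel)
  have a: "?D (?M ** mDy C J) = hatAy C J (?M ** Q)"
    by (simp add: mult entrywise_matrix_inv[OF lin leib inv] DJ entrywise_commute[OF comm(1)]
        Qy hatAy_def mcomm_def matrix_ring_simps cancel)
  \<comment> \<open>The connection matrix is the left factor in one term of the commutator and the
    right factor in the other; its variation stays folded as
    \<open>hatAy C J (?M ** Q)\<close>.\<close>
  note aD = mult[of "?M ** mDy C J", unfolded a] mult[of _ "?M ** mDy C J", unfolded a]
  have "?D (hatAy C J v) = hatAy C J (?D v) + mcomm (hatAy C J (?M ** Q)) v" for v
    unfolding hatAy_def[of C J v] hatAy_def[of C J "?D v"] mcomm_def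
    by (simp only: entrywise_add[OF lin] entrywise_diff[OF lin] aD entrywise_commute[OF comm(1)])
      (simp add: algebra_simps)
  then show ?thesis
    by (simp add: mapI_def hatR_def entrywise_commute[OF comm(2)])
qed

lemma mapI_bracket:
  fixes J X :: "'a::comm_ring_1^'n^'n"
  assumes dc: "differential_calculus C" and inv: "invertible J"
    and fr: "frechet_operator C J X Q P \<Delta>" and fr': "frechet_operator C J X Q' P' \<Delta>'"
  shows "mapI C J (entrywise \<Delta> Q' - entrywise \<Delta>' Q) =
    entrywise \<Delta> (mapI C J Q') - entrywise \<Delta>' (mapI C J Q)"
proof -
  let ?u = "matrix_inv J ** Q" and ?u' = "matrix_inv J ** Q'"
  note cancel = matrix_inv_mult_cancel[OF inv]
  \<comment> \<open>Apply \<open>\<Delta>\<close> to \<open>Q' = J u'\<close> and divide by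
    \<open>J\<close>: the extra term \<open>u u'\<close> becomes \<open>mcomm u u'\<close> after
    antisymmetrizing.\<close>
  have step: "matrix_inv J ** entrywise \<Delta> Q' =
      (matrix_inv J ** Q) ** (matrix_inv J ** Q') + entrywise \<Delta> (matrix_inv J ** Q')"
    if "frechet_operator C J X Q P \<Delta>" for Q Q' P \<Delta>
  proof -
    have lin: "clinear_op C \<Delta>" "leibniz \<Delta>" and "entrywise \<Delta> J = Q"
      using that by (simp_all add: frechet_operator_def)
    then have "entrywise \<Delta> (J ** (matrix_inv J ** Q')) =
        Q ** (matrix_inv J ** Q') + J ** entrywise \<Delta> (matrix_inv J ** Q')"
      by (simp add: entrywise_mult[OF lin])
    then show ?thesis by (simp add: matrix_ring_simps cancel)
  qed
  have u: "matrix_inv J ** (entrywise \<Delta> Q' - entrywise \<Delta>' Q) =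
      entrywise \<Delta> ?u' - entrywise \<Delta>' ?u + mcomm ?u ?u'"
    by (simp only: matrix_diff_ldistrib step[OF fr] step[OF fr'] mcomm_def) (simp add: algebra_simps)
  \<comment> \<open>Aligns the second term of \<open>hatAy_mcomm\<close> with the commutator that
    \<open>frechet_mapI\<close> yields for \<open>\<Delta>'\<close>.\<close>
  have anti: "mcomm ?u (hatAy C J ?u') = - mcomm (hatAy C J ?u') ?u" by (simp add: mcomm_def)
  show ?thesis
    unfolding frechet_mapI[OF dc inv fr] frechet_mapI[OF dc inv fr']
      entrywise_diff[OF differential_calculusD(5)[OF dc], symmetric]
    unfolding mapI_def hatR_def u
    by (simp add: hatAy_add[OF dc] hatAy_diff[OF dc] hatAy_mcomm[OF dc] anti algebra_simps)
qed

text \<open>Injectivity makes \<open>the_inv_into\<close> return \<open>Q\<close> and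
  \<open>Q'\<close>, so both brackets are formed with the same two operators and
  \<open>mapI_bracket\<close> applies.\<close>

lemma mapI_sdym3_bracket:
  fixes J X :: "'a::comm_ring_1^'n^'n"
  assumes dc: "differential_calculus C" and inv: "invertible J"
    and cs: "characteristic_spaces C J SQ SP" and fr: "frechet_derivatives_exist C J X SQ"
    and "Q \<in> SQ" "Q' \<in> SQ"
  shows "mapI C J (sdym3_bracket C J X Q Q') =
    psdym3_bracket C J X SQ (mapI C J Q) (mapI C J Q')"
proof -
  have "frechet_operator C J X R (mapI C J R) (frechet C J X R (mapI C J R))" if "R \<in> SQ" for R
    using fr that unfolding frechet_derivatives_exist_def frechet_def by (metis theI')
  from mapI_bracket[OF dc inv this this, OF assms(5,6)] show ?thesis
    by (simp add: sdym3_bracket_def psdym3_bracket_def assms(5,6)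
        the_inv_into_f_f[OF inj_on_mapI[OF dc cs]])
qed

lemma infinite_dimensional_image:
  fixes f :: "'a::comm_ring_1^'n^'n \<Rightarrow> 'a^'n^'n"
  assumes lin: "Vector_Spaces.linear (cscale C) (cscale C) f"
    and sub: "csubspace C V" and inj: "inj_on f V" and inf: "infinite_dimensional C V"
  shows "infinite_dimensional C (f ` V)"
  unfolding infinite_dimensional_def
proof
  interpret f: Vector_Spaces.linear "cscale C" "cscale C" f by (rule lin)
  assume "\<exists>B. finite B \<and> f ` V \<subseteq> cspan C B"
  then obtain B where B: "finite B" "f ` V \<subseteq> cspan C B" by blast
  \<comment> \<open>\<open>B\<close> may lie outside \<open>f\<close>
    V\<open>and so have no preimages in\<close>V\<open>. A maximal independent subset of\<close>f
    \<open>V\<close> does have them, and the exchange bound by \<open>B\<close> makes it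
    finite.\<close>
  obtain B' where B': "B' \<subseteq> f ` V" "\<not> module.dependent (cscale C) B'" "f ` V \<subseteq> cspan C B'"
    using f.vs1.maximal_independent_subset[of "f ` V"] by blast
  have "finite B'" using f.vs1.independent_span_bound[OF B(1) B'(2)] B'(1) B(2) by blast
  then obtain A where A: "A \<subseteq> V" "finite A" "B' = f ` A"
    using B'(1) finite_subset_image by metis
  have AV: "cspan C A \<subseteq> V" using f.vs1.span_minimal[OF A(1) sub] .
  have "f ` V \<subseteq> f ` cspan C A" using B'(3) A(3) f.span_image by simp
  \<comment> \<open>Since \<open>cspan C A\<close> lies in \<open>V\<close>, injectivity on
    \<open>V\<close> allows \<open>f\<close> to be cancelled.\<close>
  then have "V \<subseteq> cspan C A" using inj_on_image_subset_iff[OF inj _ AV] by blast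
  then show False using inf A(2) by (auto simp: infinite_dimensional_def)
qed

theorem proposition4:
  fixes C :: "'a::comm_ring_1 calc"
    and J X Q0 \<Phi>0 :: "'a^'n^'n"
    and SQ SP :: "('a^'n^'n) set"
    and Q \<Phi> :: "nat \<Rightarrow> 'a^'n^'n"
  assumes "differential_calculus C"
    and "SL_valued J" and "sl_valued X"
    and "sdym3 C J" and "psdym3 C X" and "connected_fields C J X"
    and "characteristic_spaces C J SQ SP"
    and "frechet_derivatives_exist C J X SQ"
    and "brackets_closed C J X SQ SP"
    and "Q0 \<in> SQ" and "\<Phi>0 = mapI C J Q0"
    and "\<And>n. Q n = (hatT C J ^^ n) Q0"
    and "\<And>n. \<Phi> n = (hatR C J ^^ n) \<Phi>0"
    and "generates_inf_dim_lie_subalgebra C (sdym3_bracket C J X) SQ (range Q)"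
  shows "generates_inf_dim_lie_subalgebra C (psdym3_bracket C J X SQ) SP (range \<Phi>) \<and>
    lie_isomorphic C (cspan C (range Q)) (sdym3_bracket C J X)
      (cspan C (range \<Phi>)) (psdym3_bracket C J X SQ)"
proof -
  note dc = assms(1) and cs = assms(7)
  let ?I = "mapI C J"
  let ?V = "cspan C (range Q)"
  interpret I: Vector_Spaces.linear "cscale C" "cscale C" ?I
    by (rule linear_mapI[OF dc])
  have inv: "invertible J" using assms(2) by (simp add: SL_valued_def)
  have SQ: "csubspace C SQ" and SP: "?I ` SQ = SP"
    using cs by (simp_all add: characteristic_spaces_def)
  have QS: "range Q \<subseteq> SQ"
    and infQ: "infinite_dimensional C ?V"
    and closed: "\<And>u v. u \<in> ?V \<Longrightarrow> v \<in> ?V \<Longrightarrow> sdym3_bracket C J X u v \<in> ?V"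
    using assms(14) by (simp_all add: generates_inf_dim_lie_subalgebra_def)
  have VS: "?V \<subseteq> SQ" using I.vs1.span_minimal[OF QS SQ] .
  have inj: "inj_on ?I ?V" using inj_on_subset[OF inj_on_mapI[OF dc cs] VS] .
  have hom: "?I (sdym3_bracket C J X u v) = psdym3_bracket C J X SQ (?I u) (?I v)"
    if "u \<in> ?V" "v \<in> ?V" for u v
    using mapI_sdym3_bracket[OF dc inv cs assms(8)] that VS by blast
  \<comment> \<open>Each induction step moves \<open>mapI\<close> past one \<open>hatT\<close>,
    turning it into \<open>hatR\<close>.\<close>
  have "\<Phi> n = ?I (Q n)" for n
    unfolding assms(11-13) by (induction n) (simp_all add: mapI_hatT[OF inv])
  then have ran: "range \<Phi> = ?I ` range Q" by (simp add: image_image)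
  then have W: "cspan C (range \<Phi>) = ?I ` ?V" by (simp add: I.span_image)
  have "range \<Phi> \<subseteq> SP" using ran QS SP by blast
  moreover have "infinite_dimensional C (cspan C (range \<Phi>))"
    unfolding W by (rule infinite_dimensional_image[OF linear_mapI[OF dc] _ inj infQ]) simp
  \<comment> \<open>Pull both arguments back to \<open>?V\<close>, take the bracket there by
    \<open>closed\<close>, and return by \<open>hom\<close>.\<close>
  moreover have "psdym3_bracket C J X SQ u v \<in> ?I ` ?V" if "u \<in> ?I ` ?V" "v \<in> ?I ` ?V" for u v
    using that closed hom by (smt (verit) image_iff)
  moreover have "lie_isomorphic C ?V (sdym3_bracket C J X) (?I ` ?V) (psdym3_bracket C J X SQ)"
    unfolding lie_isomorphic_def using inj hom
    by (intro exI[of _ ?I]) (simp add: bij_betw_def I.add I.scale)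
  ultimately show ?thesis
    unfolding generates_inf_dim_lie_subalgebra_def W by blast
qed

end
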